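(* For all $\zeta,\epsilon>0$ there is $\eta>0$ such that the following holds for all $p,\rho\in[\zeta,1-\zeta]$. If $f\colon(\{0,1\}^n,\mu_{\rho p})\to\{0,1\}$, $g\colon(\{0,1\}^n,\mu_p)\to\{0,1\}$ and $h\colon(\{0,1\}^n,\mu_\rho)\to\{0,1\}$ satisfy \[ \Pr_{\mathbf{x}\sim\mu_p,\ \mathbf{y}\sim\mu_\rho}\big[f(\mathbf{x}\wedge\mathbf{y})=g(\mathbf{x})\wedge h(\mathbf{y})\big]\ge1-\eta, \] with $\mathbf{x},\mathbf{y}$ independent, then one of the following holds: (1) $f$ and at least one of the functions $g$ or $h$ are $\epsilon$-close to the constant $0$ function; (2) there is a set $T\subseteq[n]$ such that $f,g,h$ are all $\epsilon$-close to $\mathsf{AND}_T$ (each with respect to its own input distribution).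
   Context: $\mu_q$ is the $q$-biased product measure on $\{0,1\}^n$; $x\wedge y$ is coordinatewise AND; $\mathsf{AND}_T(x)=\bigwedge_{i\in T}x_i$. A Boolean function on $(\{0,1\}^n,\mu_q)$ is $\epsilon$-close to another if they differ with probability at most $\epsilon$ under $\mu_q$. *)

theory Defs
  imports "HOL-Probability.Probability"
begin

text \<open>
  A point of \<open>{0,1}\<^sup>n\<close> is a function \<open>nat \<Rightarrow> bool\<close> that is \<open>False\<close> outside \<open>{..<n}\<close>, and
  \<open>\<mu> n q\<close> gives probability 0 to all other functions. So a Boolean function on the cube may be
  taken to be any \<open>(nat \<Rightarrow> bool) \<Rightarrow> bool\<close>: its values off the cube affect no probability.
\<close>

definition \<mu> :: "nat \<Rightarrow> real \<Rightarrow> (nat \<Rightarrow> bool) pmf"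
  where "\<mu> n q = Pi_pmf {..<n} False (\<lambda>_. bernoulli_pmf q)"

definition cube_and :: "(nat \<Rightarrow> bool) \<Rightarrow> (nat \<Rightarrow> bool) \<Rightarrow> nat \<Rightarrow> bool"
  where "cube_and x y = (\<lambda>i. x i \<and> y i)"

definition AND_fun :: "nat set \<Rightarrow> (nat \<Rightarrow> bool) \<Rightarrow> bool"
  where "AND_fun T x \<longleftrightarrow> (\<forall>i\<in>T. x i)"

definition is_close ::
  "nat \<Rightarrow> real \<Rightarrow> real \<Rightarrow> ((nat \<Rightarrow> bool) \<Rightarrow> bool) \<Rightarrow> ((nat \<Rightarrow> bool) \<Rightarrow> bool) \<Rightarrow> bool"
  where "is_close n q \<epsilon> F G \<longleftrightarrow> measure_pmf.prob (\<mu> n q) {x. F x \<noteq> G x} \<le> \<epsilon>"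

lemma pmf_\<mu>:
  assumes "0 \<le> q" "q \<le> 1"
  shows "pmf (\<mu> n q) x =
    (if \<forall>i\<ge>n. \<not> x i then \<Prod>i<n. if x i then q else 1 - q else 0)"
proof -
  have "pmf (bernoulli_pmf q) b = (if b then q else 1 - q)" for b
    using assms by (cases b) auto
  then show ?thesis
    unfolding \<mu>_def by (subst pmf_Pi) (auto simp: not_less)
qed

end

theory Submission
  imports Defs
begin

text \<open>
  For \<open>y\<close> with \<open>h y\<close>, the value \<open>g x\<close> is nearly the function \<open>f (x \<and> y)\<close> of the coordinates where
  \<open>y\<close> is 1, so resampling \<open>x\<close> on the zero set of \<open>y\<close> hardly changes \<open>g\<close>. If \<open>h\<close> has mass at least
  \<open>\<beta>\<close>, then a second moment bound shows that all but boundedly many coordinates lie in this zero set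
  with probability bounded below, given \<open>h y\<close>. Fractional subadditivity of the variance over these
  random zero sets shows that \<open>g\<close> nearly depends on boundedly many coordinates \<open>J\<close>, where the size of
  \<open>J\<close> does not depend on \<open>\<eta>\<close>; symmetrically for \<open>h\<close>. Every point of \<open>{0,1}\<^sup>J\<close> has mass bounded
  below, so for small \<open>\<eta>\<close> the conditional means of \<open>f\<close>, \<open>g\<close>, \<open>h\<close> given their \<open>J\<close>-coordinates round
  to functions that satisfy the equation exactly, and such functions are ANDs or trivial.
\<close>

section \<open>Resampling a set of coordinates\<close>

text \<open>This is the conditional expectation of \<open>F\<close> given the coordinates outside
  \<open>R\<close>. It is kept as a function on all points, so that such averages compose as
  operators.\<close>

definition resample ::
  "real \<Rightarrow> nat set \<Rightarrow> ((nat \<Rightarrow> bool) \<Rightarrow> real) \<Rightarrow> (nat \<Rightarrow> bool) \<Rightarrow> real"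
  where "resample q R F x =
    measure_pmf.expectation (Pi_pmf R False (\<lambda>_. bernoulli_pmf q)) (\<lambda>y. F (override_on x y R))"

lemma finite_set_Pi_bernoulli:
  "finite R \<Longrightarrow> finite (set_pmf (Pi_pmf R False (\<lambda>_. bernoulli_pmf q)))"
  by (subst set_Pi_pmf) (simp_all add: finite_PiE_dflt)

lemma finite_set_\<mu>: "finite (set_pmf (\<mu> n q))"
  unfolding \<mu>_def by (rule finite_set_Pi_bernoulli) simp

lemma integrable_Pi_bernoulli [simp]:
  fixes F :: "(nat \<Rightarrow> bool) \<Rightarrow> real"
  assumes "finite R"
  shows "integrable (measure_pmf (Pi_pmf R False (\<lambda>_. bernoulli_pmf q))) F"
  by (intro integrable_measure_pmf_finite finite_set_Pi_bernoulli assms)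

lemma integrable_\<mu> [simp]:
  fixes F :: "(nat \<Rightarrow> bool) \<Rightarrow> real"
  shows "integrable (measure_pmf (\<mu> n q)) F"
  by (intro integrable_measure_pmf_finite finite_set_\<mu>)

lemma expectation_pair_pmf_finite:
  fixes F :: "'a \<times> 'b \<Rightarrow> real"
  assumes "finite (set_pmf P)" "finite (set_pmf Q)"
  shows "measure_pmf.expectation (pair_pmf P Q) F =
    measure_pmf.expectation P (\<lambda>x. measure_pmf.expectation Q (\<lambda>y. F (x, y)))"
proof -
  have "measure_pmf.expectation (pair_pmf P Q) F =
      (\<Sum>(x, y) \<in> set_pmf P \<times> set_pmf Q. pmf P x * (pmf Q y * F (x, y)))"
    using assms
    by (subst integral_measure_pmf[of "set_pmf P \<times> set_pmf Q"])
       (auto intro!: sum.cong simp: pmf_pair mult.assoc)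
  also have "\<dots> = (\<Sum>x\<in>set_pmf P. pmf P x * (\<Sum>y\<in>set_pmf Q. pmf Q y * F (x, y)))"
    by (simp add: sum.cartesian_product[symmetric] sum_distrib_left)
  also have "\<dots> = measure_pmf.expectation P (\<lambda>x. measure_pmf.expectation Q (\<lambda>y. F (x, y)))"
    using assms
    by (subst integral_measure_pmf[of "set_pmf P"], simp, force,
        subst integral_measure_pmf[of "set_pmf Q"]) (auto intro!: sum.cong)
  finally show ?thesis .
qed

lemma resample_empty [simp]: "resample q {} F = F"
  by (simp add: resample_def fun_eq_iff)

lemma resample_const [simp]: "resample q R (\<lambda>_. c) x = c"
  by (simp add: resample_def)

lemma resample_add:
  "finite R \<Longrightarrow> resample q R (\<lambda>x. F x + G x) x = resample q R F x + resample q R G x"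
  by (simp add: resample_def)

lemma resample_diff:
  "finite R \<Longrightarrow> resample q R (\<lambda>x. F x - G x) x = resample q R F x - resample q R G x"
  by (simp add: resample_def)

lemma resample_cmult: "resample q R (\<lambda>x. c * F x) x = c * resample q R F x"
  by (simp add: resample_def)

lemma resample_mono:
  assumes "finite R" "\<And>x. F x \<le> G x"
  shows "resample q R F x \<le> resample q R G x"
  using assms by (auto simp: resample_def intro!: integral_mono)

lemma resample_nonneg:
  assumes "\<And>x. 0 \<le> F x"
  shows "0 \<le> resample q R F x"
  using assms by (simp add: resample_def)

lemma override_on_override_on [simp]:
  "override_on (override_on x y R) z R = override_on x z R"
  by (auto simp: override_on_def)

lemma resample_override_on [simp]: "resample q R F (override_on x y R) = resample q R F x"
  by (simp add: resample_def)

text \<open>A factor that ignores the coordinates in \<open>R\<close> is constant during the redraw: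
  the rule of taking out what is known.\<close>

lemma resample_mult_invariant:
  assumes "\<And>x y. u (override_on x y R) = u x"
  shows "resample q R (\<lambda>x. u x * F x) x = u x * resample q R F x"
  by (simp add: resample_def assms)

lemma resample_invariant:
  assumes "\<And>x y. u (override_on x y R) = u x"
  shows "resample q R u x = u x"
  by (simp add: resample_def assms)

lemma resample_idem [simp]: "resample q R (resample q R F) = resample q R F"
  by (intro ext resample_invariant) simp

text \<open>Bits on disjoint blocks are independent, so they can be redrawn one block after the
  other. This is the tower property of conditional expectations.\<close>

lemma resample_Un:
  assumes "finite R" "finite S" "R \<inter> S = {}"
  shows "resample q (R \<union> S) F = resample q R (resample q S F)"
proof
  fix x :: "nat \<Rightarrow> bool"
  have *: "override_on x (\<lambda>i. if i \<in> R then y i else z i) (R \<union> S) =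
      override_on (override_on x y R) z S" for y z :: "nat \<Rightarrow> bool"
    using assms(3) by (auto simp: override_on_def fun_eq_iff)
  show "resample q (R \<union> S) F x = resample q R (resample q S F) x"
    unfolding resample_def
    by (simp add: Pi_pmf_union assms expectation_pair_pmf_finite finite_set_Pi_bernoulli * )
qed

lemma resample_singleton:
  assumes "0 \<le> q" "q \<le> 1"
  shows "resample q {k} F = (\<lambda>x. q * F (x(k := True)) + (1 - q) * F (x(k := False)))"
proof
  fix x :: "nat \<Rightarrow> bool"
  have "override_on x (\<lambda>i. i = k) {k} = x(k := True)" "override_on x (\<lambda>_. False) {k} = x(k := False)"
    by (auto simp: override_on_def)
  then show "resample q {k} F x = q * F (x(k := True)) + (1 - q) * F (x(k := False))"
    using assms by (simp add: resample_def Pi_pmf_singleton)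
qed

lemma resample_insert:
  assumes "finite R" "k \<notin> R"
  shows "resample q (insert k R) F = resample q R (resample q {k} F)"
    and "resample q (insert k R) F = resample q {k} (resample q R F)"
  using resample_Un[of R "{k}" q F] resample_Un[of "{k}" R q F] assms by auto

text \<open>Jensen's inequality, from the nonnegativity of the variance about the mean
  \<open>c\<close>.\<close>

lemma power2_resample_le:
  assumes "finite R"
  shows "(resample q R F x)\<^sup>2 \<le> resample q R (\<lambda>x. (F x)\<^sup>2) x"
proof -
  define c where "c = resample q R F x"
  have "0 \<le> resample q R (\<lambda>x. (F x - c)\<^sup>2) x"
    by (rule resample_nonneg) simp
  also have "(\<lambda>x. (F x - c)\<^sup>2) = (\<lambda>x. ((F x)\<^sup>2 - (2 * c) * F x) + c\<^sup>2)"
    by (simp add: power2_eq_square algebra_simps)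
  also have "resample q R \<dots> x = resample q R (\<lambda>x. (F x)\<^sup>2) x - 2 * c * c + c\<^sup>2"
    using assms by (simp only: resample_add resample_diff resample_cmult resample_const) (simp add: c_def)
  finally show ?thesis
    by (simp add: c_def power2_eq_square)
qed

text \<open>With probability at least \<open>c ^ card R\<close> all redrawn bits agree with
  \<open>x\<close>, and the other outcomes contribute nonnegatively. The loss depends on the number
  of redrawn coordinates only.\<close>

lemma resample_ge_power:
  assumes "finite R" "0 \<le> c" "c \<le> q" "c \<le> 1 - q" "\<And>x. 0 \<le> F x"
  shows "c ^ card R * F x \<le> resample q R F x"
  using assms(1,5)
proof (induction R arbitrary: F)
  case (insert k R)
  have one: "c * F x \<le> resample q {k} F x" for x
  proof -
    have "c * F x = c * F (x(k := x k))"
      by simp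
    also have "\<dots> \<le> q * F (x(k := True)) + (1 - q) * F (x(k := False))"
    proof (cases "x k")
      case True
      then show ?thesis
        using assms(2-4) insert.prems
        by (simp del: fun_upd_triv add: add_increasing2 mult_right_mono)
    next
      case False
      then show ?thesis
        using assms(2-4) insert.prems
        by (simp del: fun_upd_triv add: add_increasing mult_right_mono)
    qed
    finally show ?thesis
      using assms(2-4) by (simp add: resample_singleton)
  qed
  have "c ^ card (insert k R) * F x = c * (c ^ card R * F x)"
    using insert by simp
  also have "\<dots> \<le> c * resample q R F x"
    using insert assms by (intro mult_left_mono) auto
  also have "\<dots> = resample q R (\<lambda>x. c * F x) x"
    by (simp add: resample_cmult)
  also have "\<dots> \<le> resample q R (resample q {k} F) x"
    using insert.hyps one by (intro resample_mono) auto
  finally show ?case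
    by (simp add: resample_insert(1)[OF insert.hyps])
qed simp

text \<open>The AND of independent bits with biases \<open>p\<close> and \<open>r\<close> has bias
  \<open>r * p\<close>. Outside \<open>R\<close> the bits stay those of \<open>a\<close> and
  \<open>b\<close>.\<close>

lemma resample_cube_and:
  assumes "finite R" "0 \<le> p" "p \<le> 1" "0 \<le> r" "r \<le> 1"
  shows "resample p R (\<lambda>x. resample r R (\<lambda>y. F (cube_and x y)) b) a =
    resample (r * p) R F (cube_and a b)"
  using assms(1)
proof (induction R arbitrary: F a b)
  case (insert k R)
  have rp: "0 \<le> r * p" "r * p \<le> 1"
    using assms by (auto intro: mult_le_one)
  have upd: "cube_and (x(k := s)) (y(k := t)) = (cube_and x y)(k := s \<and> t)" for x y s t
    by (auto simp: cube_and_def)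
  have "resample p (insert k R) (\<lambda>x. resample r (insert k R) (\<lambda>y. F (cube_and x y)) b) a =
     resample p R (\<lambda>x. resample r R (\<lambda>y. p * (r * F (cube_and (x(k := True)) (y(k := True))) +
         (1 - r) * F (cube_and (x(k := True)) (y(k := False)))) +
       (1 - p) * (r * F (cube_and (x(k := False)) (y(k := True))) +
         (1 - r) * F (cube_and (x(k := False)) (y(k := False))))) b) a"
    using insert.hyps assms
    by (simp add: resample_insert(1)[OF insert.hyps] resample_singleton resample_add resample_cmult distrib_left)
  also have "\<dots> = resample p R (\<lambda>x. resample r R (\<lambda>y. resample (r * p) {k} F (cube_and x y)) b) a"
    unfolding resample_singleton[OF rp] by (simp add: upd algebra_simps)
  also have "\<dots> = resample (r * p) R (resample (r * p) {k} F) (cube_and a b)"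
    by (rule insert.IH)
  finally show ?case
    by (simp add: resample_insert(1)[OF insert.hyps])
qed simp

text \<open>Redrawing all of \<open>{..<n}\<close> leaves only the values of \<open>x\<close> from
  index \<open>n\<close> on, which must be \<open>False\<close> as they are for every sample from
  \<open>\<mu>\<close>.\<close>

lemma expectation_\<mu>:
  assumes "\<And>i. n \<le> i \<Longrightarrow> \<not> x i"
  shows "measure_pmf.expectation (\<mu> n q) F = resample q {..<n} F x"
proof -
  have "override_on x y {..<n} = y" if "y \<in> set_pmf (\<mu> n q)" for y
    using that assms set_Pi_pmf_subset[of "{..<n}" False "\<lambda>_. bernoulli_pmf q"]
    by (auto simp: \<mu>_def override_on_def fun_eq_iff)
  then show ?thesis
    unfolding resample_def \<mu>_def[symmetric]
    by (intro integral_cong_AE) (auto simp: AE_measure_pmf_iff)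
qed

lemma expectation_resample:
  assumes "R \<subseteq> {..<n}"
  shows "measure_pmf.expectation (\<mu> n q) (resample q R F) = measure_pmf.expectation (\<mu> n q) F"
proof -
  have fin: "finite R"
    using assms finite_subset by blast
  have "{..<n} = ({..<n} - R) \<union> R"
    using assms by auto
  then have "resample q {..<n} G = resample q ({..<n} - R) (resample q R G)" for G
    using resample_Un[of "{..<n} - R" R q G] fin by (metis Diff_disjoint Int_commute finite_Diff finite_lessThan)
  then show ?thesis
    by (simp add: expectation_\<mu>[of n "\<lambda>_. False"])
qed

lemma expectation_power2_resample_le:
  assumes "R \<subseteq> {..<n}"
  shows "measure_pmf.expectation (\<mu> n q) (\<lambda>x. (resample q R F x)\<^sup>2)
    \<le> measure_pmf.expectation (\<mu> n q) (\<lambda>x. (F x)\<^sup>2)"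
proof -
  have "finite R"
    using assms finite_subset by blast
  then have "measure_pmf.expectation (\<mu> n q) (\<lambda>x. (resample q R F x)\<^sup>2)
      \<le> measure_pmf.expectation (\<mu> n q) (resample q R (\<lambda>x. (F x)\<^sup>2))"
    by (intro integral_mono) (auto intro: power2_resample_le)
  then show ?thesis
    by (simp add: expectation_resample assms)
qed

text \<open>Pythagoras: averaging over \<open>R\<close> is an orthogonal projection in L2, so the
  cross term equals the squared norm of the projection.\<close>

lemma expectation_power2_diff_resample:
  assumes "R \<subseteq> {..<n}"
  shows "measure_pmf.expectation (\<mu> n q) (\<lambda>x. (F x - resample q R F x)\<^sup>2) =
    measure_pmf.expectation (\<mu> n q) (\<lambda>x. (F x)\<^sup>2) -
    measure_pmf.expectation (\<mu> n q) (\<lambda>x. (resample q R F x)\<^sup>2)"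
proof -
  let ?A = "resample q R F"
  have "measure_pmf.expectation (\<mu> n q) (\<lambda>x. ?A x * F x) =
      measure_pmf.expectation (\<mu> n q) (resample q R (\<lambda>x. ?A x * F x))"
    by (simp add: expectation_resample assms)
  also have "resample q R (\<lambda>x. ?A x * F x) = (\<lambda>x. (?A x)\<^sup>2)"
    by (simp add: resample_mult_invariant power2_eq_square fun_eq_iff)
  finally have cross: "measure_pmf.expectation (\<mu> n q) (\<lambda>x. ?A x * F x) =
      measure_pmf.expectation (\<mu> n q) (\<lambda>x. (?A x)\<^sup>2)" .
  have "(\<lambda>x. (F x - ?A x)\<^sup>2) = (\<lambda>x. (F x)\<^sup>2 + (?A x)\<^sup>2 - 2 * (?A x * F x))"
    by (simp add: power2_eq_square algebra_simps)
  then show ?thesis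
    by (simp add: cross)
qed

section \<open>Stability under random resampling\<close>

text \<open>
  A Shearer-type inequality for the variance: insert the elements of \<open>K\<close> in some order and let \<open>d k\<close>
  be the increment of \<open>V\<close> at \<open>k\<close>; the increments of \<open>V\<close> decrease as the base set grows.
\<close>

lemma influence_decomposition:
  fixes q n F
  defines "V \<equiv> \<lambda>R. measure_pmf.expectation (\<mu> n q) (\<lambda>x. (F x)\<^sup>2) -
    measure_pmf.expectation (\<mu> n q) (\<lambda>x. (resample q R F x)\<^sup>2)"
  assumes "K \<subseteq> {..<n}"
  shows "\<exists>d. (\<forall>k. 0 \<le> d k) \<and> V K = sum d K \<and> (\<forall>R\<subseteq>K. sum d R \<le> V R)"
proof -
  have "finite K"
    using assms finite_subset by blast
  then show ?thesis
    using assms(2)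
  proof (induction K)
    case empty
    then show ?case
      by (auto simp: V_def intro: exI[of _ "\<lambda>_. 0"])
  next
    case (insert k K)
    let ?N = "\<lambda>F. measure_pmf.expectation (\<mu> n q) (\<lambda>x. (F x)\<^sup>2)"
    let ?A = "\<lambda>R. resample q R F"
    from insert obtain d where d: "\<forall>k. 0 \<le> d k" "V K = sum d K" "\<forall>R\<subseteq>K. sum d R \<le> V R"
      by auto
    \<comment> \<open>The new weight is the increment of \<open>V\<close> over the largest base set,
      hence the smallest increment that \<open>k\<close> can cause.\<close>
    define v where "v = V (insert k K) - V K"
    \<comment> \<open>Pythagoras for \<open>?A R\<close> and the single coordinate
      \<open>k\<close>.\<close>
    have incr: "V (insert k R) - V R = ?N (\<lambda>x. ?A R x - resample q {k} (?A R) x)"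
      if "R \<subseteq> K" for R
    proof -
      have "finite R" "k \<notin> R"
        using that insert.hyps finite_subset by auto
      then show ?thesis
        using insert.prems
        by (simp add: V_def expectation_power2_diff_resample resample_insert(2)[of R k])
    qed
    \<comment> \<open>Averaging over \<open>K - R\<close> turns the difference function for
      \<open>R\<close> into the one for \<open>K\<close>, and averaging does not increase the L2
      norm.\<close>
    have v_le: "v \<le> V (insert k R) - V R" if "R \<subseteq> K" for R
    proof -
      have fin: "finite R" "finite (K - R)"
        using that insert.hyps finite_subset by auto
      have K: "K = (K - R) \<union> R" "insert k K = (K - R) \<union> insert k R"
        using that by auto
      have 1: "?A K = resample q (K - R) (?A R)"
        by (subst K(1), rule resample_Un) (use fin in auto)
      have 2: "resample q {k} (?A K) = resample q (K - R) (resample q {k} (?A R))"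
      proof -
        have "resample q {k} (?A K) = ?A (insert k K)"
          by (rule resample_insert(2)[symmetric]) (use insert.hyps in auto)
        also have "\<dots> = resample q (K - R) (?A (insert k R))"
          by (subst K(2), rule resample_Un) (use fin insert.hyps in auto)
        also have "?A (insert k R) = resample q {k} (?A R)"
          by (rule resample_insert(2)) (use fin insert.hyps that in auto)
        finally show ?thesis .
      qed
      have "v = ?N (\<lambda>x. ?A K x - resample q {k} (?A K) x)"
        by (simp add: v_def incr)
      also have "\<dots> = ?N (resample q (K - R) (\<lambda>x. ?A R x - resample q {k} (?A R) x))"
        unfolding 2 unfolding 1 by (simp add: resample_diff fin)
      also have "\<dots> \<le> ?N (\<lambda>x. ?A R x - resample q {k} (?A R) x)"
        by (rule expectation_power2_resample_le) (use insert.prems in auto)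
      finally show ?thesis
        using incr[OF that] by simp
    qed
    have "0 \<le> v"
      by (simp add: v_def incr)
    moreover have "sum (d(k := v)) R \<le> V R" if R: "R \<subseteq> insert k K" for R
    proof (cases "k \<in> R")
      case True
      define R' where "R' = R - {k}"
      have R': "R = insert k R'" "k \<notin> R'" "R' \<subseteq> K"
        using R True by (auto simp: R'_def)
      have fin: "finite R'"
        using R'(3) insert.hyps finite_subset by blast
      have "sum (d(k := v)) R = v + sum d R'"
        using R'(2) fin by (auto simp: R'(1) intro!: sum.cong)
      also have "\<dots> \<le> (V R - V R') + V R'"
        using v_le[OF R'(3)] d(3) R' by (intro add_mono) auto
      finally show ?thesis by simp
    next
      case False
      then have "R \<subseteq> K" using R by auto
      moreover have "sum (d(k := v)) R = sum d R"
        using False by (intro sum.cong) auto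
      ultimately show ?thesis using d(3) by simp
    qed
    moreover have "V (insert k K) = sum (d(k := v)) (insert k K)"
    proof -
      have "sum (d(k := v)) K = sum d K"
        using insert.hyps by (intro sum.cong) auto
      then show ?thesis
        using insert.hyps d(2) by (simp add: v_def)
    qed
    ultimately show ?case
      using d(1) by (intro exI[of _ "d(k := v)"]) auto
  qed
qed

text \<open>Among functions that ignore \<open>R\<close>, the average over \<open>R\<close> is the
  best L2 approximation of \<open>F\<close>. Subtracting such a \<open>u\<close> from
  \<open>F\<close> does not change the distance to the average, and this distance is at most the
  norm of \<open>F - u\<close>.\<close>

lemma power2_dist_resample_le:
  assumes "R \<subseteq> {..<n}" "\<And>x y. u (override_on x y R) = u x"
  shows "measure_pmf.expectation (\<mu> n q) (\<lambda>x. (F x)\<^sup>2) -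
      measure_pmf.expectation (\<mu> n q) (\<lambda>x. (resample q R F x)\<^sup>2)
    \<le> measure_pmf.expectation (\<mu> n q) (\<lambda>x. (F x - u x)\<^sup>2)"
proof -
  have fin: "finite R"
    using assms(1) finite_subset by blast
  have "(\<lambda>x. (F x - resample q R F x)\<^sup>2) =
      (\<lambda>x. ((F x - u x) - resample q R (\<lambda>x. F x - u x) x)\<^sup>2)"
    using assms(2) by (simp add: resample_diff fin resample_invariant)
  then show ?thesis
    unfolding expectation_power2_diff_resample[OF assms(1), symmetric]
    by (simp add: expectation_power2_diff_resample[OF assms(1), of q "\<lambda>x. F x - u x"])
qed

text \<open>The random set is the zero set of \<open>y\<close> inside \<open>K\<close>, counted only
  when \<open>h y\<close> holds. Each \<open>k\<close> in \<open>K\<close> is hit with probability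
  at least \<alpha>, so averaging the Shearer-type inequality over \<open>y\<close> loses a factor
  \<alpha>, whatever the size of \<open>K\<close>.\<close>

lemma stability:
  fixes f g h :: "(nat \<Rightarrow> bool) \<Rightarrow> bool"
  assumes K: "K \<subseteq> {..<n}"
    and influential: "\<And>k. k \<in> K \<Longrightarrow>
      \<alpha> \<le> measure_pmf.expectation (\<mu> n r) (\<lambda>y. of_bool (h y \<and> \<not> y k))"
    and error: "measure_pmf.expectation (\<mu> n r) (\<lambda>y. measure_pmf.expectation (\<mu> n p)
      (\<lambda>x. of_bool (f (cube_and x y) \<noteq> (g x \<and> h y)))) \<le> \<eta>"
  shows "\<alpha> * measure_pmf.expectation (\<mu> n p)
    (\<lambda>x. (of_bool (g x) - resample p K (\<lambda>x. of_bool (g x)) x)\<^sup>2) \<le> \<eta>"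
proof -
  let ?G = "\<lambda>x. of_bool (g x) :: real"
  let ?e = "\<lambda>y. measure_pmf.expectation (\<mu> n p) (\<lambda>x. of_bool (f (cube_and x y) \<noteq> (g x \<and> h y)))"
  obtain d where d: "\<And>k. 0 \<le> d k"
    "measure_pmf.expectation (\<mu> n p) (\<lambda>x. (?G x - resample p K ?G x)\<^sup>2) = sum d K"
    "\<And>R. R \<subseteq> K \<Longrightarrow> sum d R \<le> measure_pmf.expectation (\<mu> n p) (\<lambda>x. (?G x)\<^sup>2) -
      measure_pmf.expectation (\<mu> n p) (\<lambda>x. (resample p R ?G x)\<^sup>2)"
    using influence_decomposition[OF K, of p ?G] expectation_power2_diff_resample[OF K, of p ?G] by auto
  have fin: "finite K"
    using K finite_subset by blast
  have pointwise: "(\<Sum>k\<in>K. d k * of_bool (h y \<and> \<not> y k)) \<le> ?e y" for y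
  proof (cases "h y")
    case True
    define R where "R = {k \<in> K. \<not> y k}"
    define u where "u = (\<lambda>x. of_bool (f (cube_and x y)) :: real)"
    have "R \<subseteq> K" "R \<subseteq> {..<n}"
      using K by (auto simp: R_def)
    have "(\<Sum>k\<in>K. d k * of_bool (h y \<and> \<not> y k)) = sum d R"
      using fin True by (simp add: R_def sum.inter_filter of_bool_def if_distrib cong: if_cong)
    also have "\<dots> \<le> measure_pmf.expectation (\<mu> n p) (\<lambda>x. (?G x - u x)\<^sup>2)"
    proof (rule order_trans[OF d(3)[OF \<open>R \<subseteq> K\<close>] power2_dist_resample_le[OF \<open>R \<subseteq> {..<n}\<close>]])
      \<comment> \<open>The bits of \<open>x\<close> in \<open>R\<close> are masked by the zeros of
        \<open>y\<close>.\<close>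
      show "u (override_on x z R) = u x" for x z
      proof -
        have "cube_and (override_on x z R) y = cube_and x y"
          using K by (auto simp: cube_and_def override_on_def R_def fun_eq_iff)
        then show ?thesis by (simp add: u_def)
      qed
    qed
    also have "\<dots> = ?e y"
      using True by (intro arg_cong[of _ _ "measure_pmf.expectation (\<mu> n p)"]) (auto simp: u_def fun_eq_iff)
    finally show ?thesis .
  qed simp
  have "\<alpha> * sum d K \<le> (\<Sum>k\<in>K. d k * measure_pmf.expectation (\<mu> n r) (\<lambda>y. of_bool (h y \<and> \<not> y k)))"
    unfolding sum_distrib_left mult.commute[of \<alpha>] using influential d(1)
    by (intro sum_mono mult_left_mono) auto
  also have "\<dots> = measure_pmf.expectation (\<mu> n r) (\<lambda>y. \<Sum>k\<in>K. d k * of_bool (h y \<and> \<not> y k))"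
    by (simp add: Bochner_Integration.integral_sum)
  also have "\<dots> \<le> measure_pmf.expectation (\<mu> n r) ?e"
    by (intro integral_mono) (use pointwise in auto)
  finally show ?thesis
    using error d(2) by simp
qed

section \<open>Second moment bound for biased coordinates\<close>

lemma expectation_power2_sum_centered:
  fixes q :: real
  assumes "0 \<le> q" "q \<le> 1" "J \<subseteq> {..<n}"
  shows "measure_pmf.expectation (\<mu> n q) (\<lambda>x. (\<Sum>i\<in>J. of_bool (x i) - q)\<^sup>2) = card J * (q * (1 - q))"
proof -
  have "finite J"
    using assms(3) finite_subset by blast
  then show ?thesis
    using assms(3)
  proof (induction J)
    case (insert k J)
    let ?S = "\<lambda>x. \<Sum>i\<in>J. of_bool (x i) - q"
    \<comment> \<open>The sum over \<open>J\<close> ignores bit \<open>k\<close>, so averaging over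
      that bit kills the cross term and leaves its variance \<open>q * (1 - q)\<close>.\<close>
    have S: "?S (x(k := b)) = ?S x" for x b
      using insert.hyps by (intro sum.cong) auto
    have "measure_pmf.expectation (\<mu> n q) (\<lambda>x. (\<Sum>i\<in>insert k J. of_bool (x i) - q)\<^sup>2) =
        measure_pmf.expectation (\<mu> n q) (resample q {k} (\<lambda>x. (of_bool (x k) - q + ?S x)\<^sup>2))"
      using insert by (simp add: expectation_resample)
    also have "resample q {k} (\<lambda>x. (of_bool (x k) - q + ?S x)\<^sup>2) = (\<lambda>x. (?S x)\<^sup>2 + q * (1 - q))"
      unfolding resample_singleton[OF assms(1,2)] S
      by (simp add: power2_eq_square algebra_simps)
    also have "measure_pmf.expectation (\<mu> n q) \<dots> = card (insert k J) * (q * (1 - q))"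
      using insert by (simp add: algebra_simps)
    finally show ?case .
  qed simp
qed

text \<open>If \<open>h\<close> were independent of bit \<open>i\<close>, the probability in the
  last hypothesis would be \<open>l * (1 - q)\<close>. Each \<open>i\<close> in \<open>J\<close>
  misses this by at least half, and the total deficit is the correlation of \<open>h\<close> with a
  centered sum, which grows only like the square root of \<open>card J\<close>.\<close>

lemma card_biased_coordinates_le:
  fixes h :: "(nat \<Rightarrow> bool) \<Rightarrow> bool" and q l :: real
  assumes q: "0 \<le> q" "q < 1" and J: "J \<subseteq> {..<n}"
    and l: "l = measure_pmf.expectation (\<mu> n q) (\<lambda>x. of_bool (h x))" "0 < l"
    and biased: "\<And>i. i \<in> J \<Longrightarrow>
      measure_pmf.expectation (\<mu> n q) (\<lambda>x. of_bool (h x \<and> \<not> x i)) \<le> l * (1 - q) / 2"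
  shows "card J * (l * (1 - q)\<^sup>2) \<le> 4"
proof -
  let ?S = "\<lambda>x. \<Sum>i\<in>J. of_bool (x i) - q"
  \<comment> \<open>This weight in the AM-GM inequality below makes the quadratic term at most half
    of the left-hand side, so that it can be absorbed there.\<close>
  define t where "t = 2 / (l * (1 - q))"
  have t: "t > 0" using q l by (simp add: t_def)
  have "card J * (l * (1 - q) / 2) \<le>
     (\<Sum>i\<in>J. (1 - q) * l - measure_pmf.expectation (\<mu> n q) (\<lambda>x. of_bool (h x \<and> \<not> x i)))"
    by (rule sum_bounded_below) (use biased in \<open>fastforce simp: mult.commute\<close>)
  also have "\<dots> = measure_pmf.expectation (\<mu> n q)
      (\<lambda>x. \<Sum>i\<in>J. (1 - q) * of_bool (h x) - of_bool (h x \<and> \<not> x i))"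
    by (simp add: Bochner_Integration.integral_sum l)
  \<comment> \<open>When \<open>h x\<close> holds, the summand is
    \<open>(1 - q) - (1 - x i)\<close>, which is \<open>x i - q\<close> with the bit read as a
    number.\<close>
  also have "\<dots> = measure_pmf.expectation (\<mu> n q) (\<lambda>x. of_bool (h x) * ?S x)"
    unfolding sum_distrib_left
    by (intro arg_cong[of _ _ "measure_pmf.expectation (\<mu> n q)"] ext sum.cong) auto
  also have "\<dots> \<le> measure_pmf.expectation (\<mu> n q) (\<lambda>x. t / 2 * of_bool (h x) + (?S x)\<^sup>2 / (2 * t))"
  proof (intro integral_mono integrable_\<mu>)
    fix x
    have "0 \<le> (t * of_bool (h x) - ?S x)\<^sup>2"
      by simp
    then have "2 * t * (of_bool (h x) * ?S x) \<le> t\<^sup>2 * of_bool (h x) + (?S x)\<^sup>2"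
      by (auto simp: power2_eq_square algebra_simps)
    then show "of_bool (h x) * ?S x \<le> t / 2 * of_bool (h x) + (?S x)\<^sup>2 / (2 * t)"
      using t by (simp add: field_simps power2_eq_square)
  qed
  also have "\<dots> = t / 2 * l + card J * (q * (1 - q)) / (2 * t)"
    using q J by (simp add: l expectation_power2_sum_centered)
  also have "\<dots> \<le> t / 2 * l + card J / (2 * t)"
    using q t by (intro add_left_mono divide_right_mono mult_left_le) (auto intro: mult_le_one)
  also have "\<dots> = 1 / (1 - q) + card J * (l * (1 - q) / 4)"
    using q l by (simp add: t_def field_simps)
  finally have "card J * (l * (1 - q)) / 4 \<le> 1 / (1 - q)"
    by (simp add: field_simps)
  then show ?thesis
    using q by (simp add: field_simps power2_eq_square)
qed

section \<open>Rounding to an exact polymorphism\<close>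

lemma cube_and_commute: "cube_and x y = cube_and y x"
  by (auto simp: cube_and_def)

text \<open>Inserting the all-ones point for one argument expresses \<open>F\<close> through
  \<open>H\<close> alone and through \<open>G\<close> alone. Unless \<open>F\<close> vanishes, all
  three agree on the cube, and their common set of true points is closed under AND and upwards; its
  least element gives \<open>T\<close>.\<close>

lemma exact_and_polymorphism:
  fixes n :: nat and F G H :: "(nat \<Rightarrow> bool) \<Rightarrow> bool"
  defines "C \<equiv> {x. \<forall>i\<ge>n. \<not> x i}"
  assumes poly: "\<And>a b. a \<in> C \<Longrightarrow> b \<in> C \<Longrightarrow> F (cube_and a b) \<longleftrightarrow> G a \<and> H b"
  shows "(\<forall>x\<in>C. \<not> F x) \<and> ((\<forall>x\<in>C. \<not> G x) \<or> (\<forall>x\<in>C. \<not> H x)) \<or>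
    (\<exists>T\<subseteq>{..<n}. \<forall>x\<in>C. F x = AND_fun T x \<and> G x = AND_fun T x \<and> H x = AND_fun T x)"
proof -
  define e where "e = (\<lambda>i. i < n)"
  have e: "e \<in> C" by (auto simp: C_def e_def)
  have ex: "cube_and e x = x" "cube_and x e = x" if "x \<in> C" for x
    using that by (auto simp: C_def e_def cube_and_def fun_eq_iff not_less[symmetric])
  have C_and: "cube_and x y \<in> C" if "x \<in> C" "y \<in> C" for x y
    using that by (auto simp: C_def cube_and_def)
  have F1: "F x \<longleftrightarrow> G e \<and> H x" and F2: "F x \<longleftrightarrow> G x \<and> H e" if "x \<in> C" for x
    using poly[OF e that] poly[OF that e] ex[OF that] by simp_all
  show ?thesis
  proof (cases "F e")
    case False
    then have "\<not> G e \<or> \<not> H e"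
      using F1[OF e] by simp
    then have F0: "\<not> F x" if "x \<in> C" for x
      using F1[OF that] F2[OF that] by auto
    then have "\<not> (G a \<and> H b)" if "a \<in> C" "b \<in> C" for a b
      using poly[OF that] C_and[OF that] by auto
    with F0 show ?thesis by blast
  next
    case True
    then have "G e" "H e"
      using F1[OF e] by auto
    then have eq: "G x = F x" "H x = F x" if "x \<in> C" for x
      using F1[OF that] F2[OF that] by auto
    have mult: "F (cube_and x y) \<longleftrightarrow> F x \<and> F y" if "x \<in> C" "y \<in> C" for x y
      using poly[OF that] eq that by simp
    \<comment> \<open>A true point of least weight. For any true \<open>x\<close>, the point
      \<open>cube_and x m\<close> is true and lies below \<open>m\<close>, so it equals
      \<open>m\<close>.\<close>
    obtain m where m: "m \<in> C" "F m"
      and min: "\<And>x. x \<in> C \<Longrightarrow> F x \<Longrightarrow> card {i. m i} \<le> card {i. x i}"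
      using ex_has_least_nat[of "\<lambda>x. x \<in> C \<and> F x" e "\<lambda>x. card {i. x i}"] e True by blast
    have m_sub: "{i. m i} \<subseteq> {..<n}"
      using m(1) by (auto simp: C_def not_le[symmetric])
    have "F x = AND_fun {i. m i} x" if x: "x \<in> C" for x
    proof
      assume "F x"
      then have "card {i. m i} \<le> card {i. cube_and x m i}"
        using min[of "cube_and x m"] mult x m C_and by auto
      moreover have "{i. cube_and x m i} \<subseteq> {i. m i}"
        by (auto simp: cube_and_def)
      moreover have "finite {i. m i}"
        using m_sub finite_subset by blast
      ultimately have "{i. cube_and x m i} = {i. m i}"
        by (metis card_seteq)
      then show "AND_fun {i. m i} x"
        by (auto simp: AND_fun_def cube_and_def)
    next
      assume "AND_fun {i. m i} x"
      then have "cube_and x m = m"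
        by (auto simp: AND_fun_def cube_and_def)
      then show "F x"
        using mult[OF x m(1)] m(2) by simp
    qed
    with m_sub eq show ?thesis by blast
  qed
qed

section \<open>Pointwise bounds for conditional means\<close>

lemma set_\<mu>D: "x \<in> set_pmf (\<mu> n q) \<Longrightarrow> n \<le> i \<Longrightarrow> \<not> x i"
  using set_Pi_pmf_subset[of "{..<n}" False "\<lambda>_. bernoulli_pmf q"] by (auto simp: \<mu>_def)

lemma prob_Collect_eq_expectation:
  "measure_pmf.prob M {x. P x} = measure_pmf.expectation M (\<lambda>x. of_bool (P x))"
proof -
  have "(\<lambda>x. of_bool (P x)) = (indicator {x. P x} :: _ \<Rightarrow> real)"
    by (auto simp: indicator_def)
  then show ?thesis by simp
qed

text \<open>The pattern of \<open>x\<close> on the coordinates outside \<open>K\<close> has mass at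
  least \<open>c ^ card ({..<n} - K)\<close>, so a bound on the mean of a nonnegative function
  passes to each conditional mean.\<close>

lemma resample_le_expectation:
  assumes "K \<subseteq> {..<n}" "0 \<le> c" "c \<le> q" "c \<le> 1 - q" "\<And>x. 0 \<le> F x"
    and "\<And>i. n \<le> i \<Longrightarrow> \<not> x i"
  shows "c ^ card ({..<n} - K) * resample q K F x \<le> measure_pmf.expectation (\<mu> n q) F"
proof -
  have "finite K"
    using assms(1) finite_subset by blast
  have *: "{..<n} = ({..<n} - K) \<union> K"
    using assms(1) by auto
  have "c ^ card ({..<n} - K) * resample q K F x \<le> resample q ({..<n} - K) (resample q K F) x"
    using assms by (intro resample_ge_power) (auto intro: resample_nonneg)
  also have "\<dots> = resample q {..<n} F x"
    by (subst (2) *, subst resample_Un) (use \<open>finite K\<close> in auto)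
  also have "\<dots> = measure_pmf.expectation (\<mu> n q) F"
    using assms(6) by (rule expectation_\<mu>[symmetric])
  finally show ?thesis .
qed

text \<open>The arguments are redrawn independently, so the mean of the product factors, while the
  AND of the two redraws has bias \<open>r * p\<close>. What remains is the triangle inequality for
  averages.\<close>

lemma averaged_error:
  assumes "finite K" "0 \<le> p" "p \<le> 1" "0 \<le> r" "r \<le> 1"
  shows "\<bar>resample (r * p) K F (cube_and a b) - resample p K G a * resample r K H b\<bar>
    \<le> resample p K (\<lambda>x. resample r K (\<lambda>y. \<bar>F (cube_and x y) - G x * H y\<bar>) b) a"
proof -
  let ?A = "\<lambda>D. resample p K (\<lambda>x. resample r K (D x) b) a"
  have "?A (\<lambda>x y. F (cube_and x y) - G x * H y) =
      resample (r * p) K F (cube_and a b) - resample p K (\<lambda>x. resample r K H b * G x) a"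
    using assms by (simp add: resample_diff resample_cmult resample_cube_and mult.commute)
  then have eq: "?A (\<lambda>x y. F (cube_and x y) - G x * H y) =
      resample (r * p) K F (cube_and a b) - resample p K G a * resample r K H b"
    unfolding resample_cmult by (simp add: mult.commute)
  have "?A (\<lambda>x y. F (cube_and x y) - G x * H y) \<le> ?A (\<lambda>x y. \<bar>F (cube_and x y) - G x * H y\<bar>)"
    using assms by (intro resample_mono) auto
  moreover have "?A (\<lambda>x y. (-1) * (F (cube_and x y) - G x * H y)) \<le>
      ?A (\<lambda>x y. \<bar>F (cube_and x y) - G x * H y\<bar>)"
    using assms by (intro resample_mono) auto
  then have "- ?A (\<lambda>x y. F (cube_and x y) - G x * H y) \<le> ?A (\<lambda>x y. \<bar>F (cube_and x y) - G x * H y\<bar>)"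
    unfolding resample_cmult by simp
  ultimately show ?thesis
    unfolding eq by linarith
qed

lemma resample_bool_bounds:
  "0 \<le> resample q K (\<lambda>x. of_bool (g x)) x" "finite K \<Longrightarrow> resample q K (\<lambda>x. of_bool (g x)) x \<le> 1"
  using resample_mono[of K "\<lambda>x. of_bool (g x)" "\<lambda>_. 1" q x] by (auto intro: resample_nonneg)

text \<open>The conditional variance of the Boolean \<open>g\<close> is \<open>t * (1 - t)\<close>,
  and the bound on the global variance makes it small at every cube point.\<close>

lemma resample_bool_near_0_or_1:
  fixes g :: "(nat \<Rightarrow> bool) \<Rightarrow> bool"
  assumes K: "K \<subseteq> {..<n}" and c: "0 < c" "c \<le> q" "c \<le> 1 - q"
    and x: "\<And>i. n \<le> i \<Longrightarrow> \<not> x i"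
    and \<theta>: "0 < \<theta>" "\<theta> < 1 / 2"
    and var: "measure_pmf.expectation (\<mu> n q)
      (\<lambda>x. (of_bool (g x) - resample q K (\<lambda>x. of_bool (g x)) x)\<^sup>2) \<le> c ^ card ({..<n} - K) * (\<theta> / 2)"
  defines "t \<equiv> resample q K (\<lambda>x. of_bool (g x)) x"
  shows "\<bar>t - of_bool (t > 1 / 2)\<bar> \<le> \<theta>"
proof -
  let ?A = "resample q K (\<lambda>x. of_bool (g x))"
  have fin: "finite K"
    using K finite_subset by blast
  have "c ^ card ({..<n} - K) * resample q K (\<lambda>x. (of_bool (g x) - ?A x)\<^sup>2) x
      \<le> c ^ card ({..<n} - K) * (\<theta> / 2)"
    by (rule order_trans[OF resample_le_expectation var]) (use K c x in auto)
  then have "resample q K (\<lambda>x. (of_bool (g x) - ?A x)\<^sup>2) x \<le> \<theta> / 2"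
    using c(1) by simp
  also have "(\<lambda>x. (of_bool (g x) - ?A x)\<^sup>2) = (\<lambda>x. (1 - 2 * ?A x) * of_bool (g x) + (?A x)\<^sup>2)"
    by (auto simp: fun_eq_iff power2_eq_square algebra_simps)
  also have "resample q K \<dots> x = (1 - 2 * t) * t + t\<^sup>2"
    by (simp add: resample_add fin resample_mult_invariant resample_invariant t_def)
  finally have *: "t * (1 - t) \<le> \<theta> / 2"
    by (simp add: power2_eq_square algebra_simps)
  have t: "0 \<le> t" "t \<le> 1"
    using resample_bool_bounds(1)[of q K g x] resample_bool_bounds(2)[of K q g x] fin by (auto simp: t_def)
  show ?thesis
  proof (cases "t > 1 / 2")
    case True
    then have "1 / 2 * (1 - t) \<le> t * (1 - t)"
      using t by (intro mult_right_mono) auto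
    then show ?thesis using * True t by simp
  next
    case False
    then have "t * (1 / 2) \<le> t * (1 - t)"
      using t by (intro mult_left_mono) auto
    then show ?thesis using * False t by simp
  qed
qed

text \<open>Since \<open>G\<close> is fixed while \<open>K\<close> is redrawn, the conditional
  probability of disagreement is the distance of the conditional mean of \<open>g\<close> from the
  bit \<open>G x\<close>. Agreement of \<open>G\<close> with \<open>G'\<close> matters on the cube
  only.\<close>

lemma is_close_if_resample_near:
  assumes K: "K \<subseteq> {..<n}" and inv: "\<And>x y. G (override_on x y K) = G x"
    and near: "\<And>x. (\<And>i. n \<le> i \<Longrightarrow> \<not> x i) \<Longrightarrow> \<bar>resample q K (\<lambda>x. of_bool (g x)) x - of_bool (G x)\<bar> \<le> \<theta>"
    and eq: "\<And>x. (\<And>i. n \<le> i \<Longrightarrow> \<not> x i) \<Longrightarrow> G x = G' x"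
  shows "is_close n q \<theta> g G'"
proof -
  have fin: "finite K"
    using K finite_subset by blast
  have "measure_pmf.prob (\<mu> n q) {x. g x \<noteq> G' x} =
      measure_pmf.expectation (\<mu> n q) (\<lambda>x. of_bool (g x \<noteq> G x))"
    unfolding prob_Collect_eq_expectation using eq
    by (intro integral_cong_AE) (auto simp: AE_measure_pmf_iff dest: set_\<mu>D)
  also have "\<dots> = measure_pmf.expectation (\<mu> n q) (resample q K (\<lambda>x. of_bool (g x \<noteq> G x)))"
    by (simp add: expectation_resample K)
  also have "\<dots> \<le> measure_pmf.expectation (\<mu> n q) (\<lambda>_. \<theta>)"
  proof (rule integral_mono_AE)
    have "resample q K (\<lambda>x. of_bool (g x \<noteq> G x)) x \<le> \<theta>" if "x \<in> set_pmf (\<mu> n q)" for x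
    proof -
      have "(\<lambda>x. of_bool (g x \<noteq> G x)) = (\<lambda>x. (1 - 2 * of_bool (G x)) * of_bool (g x) + of_bool (G x) :: real)"
        by auto
      then have "resample q K (\<lambda>x. of_bool (g x \<noteq> G x)) x =
          (1 - 2 * of_bool (G x)) * resample q K (\<lambda>x. of_bool (g x)) x + of_bool (G x)"
        by (simp only: resample_add fin resample_mult_invariant resample_invariant inv)
      also have "\<dots> \<le> \<bar>resample q K (\<lambda>x. of_bool (g x)) x - of_bool (G x)\<bar>"
        by auto
      also have "\<dots> \<le> \<theta>"
        using that by (intro near) (auto dest: set_\<mu>D)
      finally show ?thesis .
    qed
    then show "AE x in \<mu> n q. resample q K (\<lambda>x. of_bool (g x \<noteq> G x)) x \<le> \<theta>"
      by (simp add: AE_measure_pmf_iff)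
  qed auto
  finally show ?thesis
    by (simp add: is_close_def)
qed

section \<open>From the error bound to an exact polymorphism\<close>

lemma expectation_\<mu>_cube_and:
  fixes F :: "(nat \<Rightarrow> bool) \<Rightarrow> real"
  assumes "0 \<le> p" "p \<le> 1" "0 \<le> r" "r \<le> 1"
  shows "measure_pmf.expectation (\<mu> n p) (\<lambda>x. measure_pmf.expectation (\<mu> n r) (\<lambda>y. F (cube_and x y))) =
    measure_pmf.expectation (\<mu> n (r * p)) F"
  using resample_cube_and[of "{..<n}" p r F "\<lambda>_. False" "\<lambda>_. False"] assms
  by (simp add: expectation_\<mu>[of n "\<lambda>_. False"] cube_and_def)

lemma expectation_\<mu>_swap:
  fixes D :: "(nat \<Rightarrow> bool) \<Rightarrow> (nat \<Rightarrow> bool) \<Rightarrow> real"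
  shows "measure_pmf.expectation (\<mu> n p) (\<lambda>x. measure_pmf.expectation (\<mu> n r) (\<lambda>y. D x y)) =
    measure_pmf.expectation (\<mu> n r) (\<lambda>y. measure_pmf.expectation (\<mu> n p) (\<lambda>x. D x y))"
  using expectation_pair_pmf_finite[OF finite_set_\<mu> finite_set_\<mu>, of n p n r "\<lambda>(x, y). D x y"]
    expectation_pair_pmf_finite[OF finite_set_\<mu> finite_set_\<mu>, of n r n p "\<lambda>(y, x). D x y"]
  by (simp add: pair_commute_pmf[of "\<mu> n p"] case_prod_unfold)

text \<open>The mean error is localized twice, at \<open>a\<close> for the first argument and at
  \<open>b\<close> for the second. Each costs a factor \<kappa>, hence the square in the
  hypothesis.\<close>

lemma biased_expectations_near:
  fixes f g h :: "(nat \<Rightarrow> bool) \<Rightarrow> bool" and K :: "nat set" and n :: nat and c p r \<eta> \<theta> :: real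
  defines "\<kappa> \<equiv> c ^ card ({..<n} - K)"
  assumes K: "K \<subseteq> {..<n}" and c: "0 < c" "c \<le> p" "c \<le> 1 - p" "c \<le> r" "c \<le> 1 - r"
    and error: "measure_pmf.expectation (\<mu> n p) (\<lambda>x. measure_pmf.expectation (\<mu> n r)
      (\<lambda>y. of_bool (f (cube_and x y) \<noteq> (g x \<and> h y)))) \<le> \<kappa>\<^sup>2 * \<theta>"
    and a: "\<And>i. n \<le> i \<Longrightarrow> \<not> a i" and b: "\<And>i. n \<le> i \<Longrightarrow> \<not> b i"
  shows "\<bar>resample (r * p) K (\<lambda>x. of_bool (f x)) (cube_and a b) -
    resample p K (\<lambda>x. of_bool (g x)) a * resample r K (\<lambda>y. of_bool (h y)) b\<bar> \<le> \<theta>"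
proof -
  let ?D = "\<lambda>x y. \<bar>of_bool (f (cube_and x y)) - of_bool (g x) * of_bool (h y)\<bar> :: real"
  have fin: "finite K"
    using K finite_subset by blast
  have D: "?D x y = of_bool (f (cube_and x y) \<noteq> (g x \<and> h y))" for x y
    by simp
  have \<kappa>: "0 < \<kappa>" using c by (simp add: \<kappa>_def)
  have "\<kappa>\<^sup>2 * resample p K (\<lambda>x. resample r K (?D x) b) a
      = \<kappa> * (\<kappa> * resample p K (\<lambda>x. resample r K (?D x) b) a)"
    by (simp add: power2_eq_square)
  also have "\<dots> \<le> \<kappa> * measure_pmf.expectation (\<mu> n p) (\<lambda>x. resample r K (?D x) b)"
    unfolding \<kappa>_def using K c a
    by (intro mult_left_mono resample_le_expectation) (auto intro: resample_nonneg)
  also have "\<dots> = measure_pmf.expectation (\<mu> n p) (\<lambda>x. \<kappa> * resample r K (?D x) b)"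
    by simp
  also have "\<dots> \<le> measure_pmf.expectation (\<mu> n p) (\<lambda>x. measure_pmf.expectation (\<mu> n r) (?D x))"
    unfolding \<kappa>_def using K c b
    by (intro integral_mono resample_le_expectation) auto
  also have "\<dots> \<le> \<kappa>\<^sup>2 * \<theta>"
    using error by (simp only: D)
  finally have "resample p K (\<lambda>x. resample r K (?D x) b) a \<le> \<theta>"
    using \<kappa> by simp
  then show ?thesis
    using averaged_error[OF fin, of p r "\<lambda>x. of_bool (f x)" a b "\<lambda>x. of_bool (g x)" "\<lambda>y. of_bool (h y)"] c
    by simp
qed

lemma polymorphism_of_large_factors:
  fixes f g h :: "(nat \<Rightarrow> bool) \<Rightarrow> bool" and n M :: nat and \<zeta> \<beta> p r \<theta> :: real
  assumes \<zeta>: "0 < \<zeta>" "\<zeta> \<le> p" "\<zeta> \<le> 1 - p" "\<zeta> \<le> r" "\<zeta> \<le> 1 - r"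
    and \<theta>: "0 < \<theta>" "\<theta> \<le> 1 / 8"
    and \<beta>: "0 < \<beta>" "8 / (\<beta> * \<zeta>\<^sup>2) \<le> real M"
    and g: "\<beta> \<le> measure_pmf.expectation (\<mu> n p) (\<lambda>x. of_bool (g x))"
    and h: "\<beta> \<le> measure_pmf.expectation (\<mu> n r) (\<lambda>y. of_bool (h y))"
    and error: "measure_pmf.expectation (\<mu> n p) (\<lambda>x. measure_pmf.expectation (\<mu> n r)
      (\<lambda>y. of_bool (f (cube_and x y) \<noteq> (g x \<and> h y)))) \<le> \<eta>"
    and \<eta>: "\<eta> \<le> \<beta> * \<zeta> / 2 * (\<zeta> ^ M * (\<theta> / 2))" "\<eta> \<le> (\<zeta> ^ M)\<^sup>2 * \<theta>"
  shows "is_close n (r * p) (3 * \<theta>) f (\<lambda>_. False) \<and>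
      (is_close n p \<theta> g (\<lambda>_. False) \<or> is_close n r \<theta> h (\<lambda>_. False)) \<or>
    (\<exists>T\<subseteq>{..<n}. is_close n (r * p) (3 * \<theta>) f (AND_fun T) \<and>
      is_close n p \<theta> g (AND_fun T) \<and> is_close n r \<theta> h (AND_fun T))"
proof -
  \<comment> \<open>A lower bound for the threshold \<open>l * (1 - q) / 2\<close> of
    \<open>card_biased_coordinates_le\<close>, valid for both factors.\<close>
  define \<alpha> where "\<alpha> = \<beta> * \<zeta> / 2"
  have "0 < \<alpha>" using \<beta> \<zeta> by (simp add: \<alpha>_def)
  have "p < 1" "r < 1" "\<zeta> \<le> 1" "0 \<le> p" "0 \<le> r" using \<zeta> by linarith+
  define free where "free = (\<lambda>q u. {k \<in> {..<n}.
    \<alpha> \<le> measure_pmf.expectation (\<mu> n q) (\<lambda>y. of_bool (u y \<and> \<not> y k))})"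
  \<comment> \<open>Stability of \<open>g\<close> needs coordinates free for \<open>h\<close>, and
    stability of \<open>h\<close> needs coordinates free for \<open>g\<close>. The intersection
    serves both, and its complement has at most twice \<open>4 / (\<beta> * \<zeta>\<^sup>2)\<close>
    elements, hence at most \<open>M\<close>.\<close>
  define K where "K = free p g \<inter> free r h"
  have K: "K \<subseteq> {..<n}" by (auto simp: K_def free_def)
  then have fin: "finite K"
    using finite_subset by blast
  have card_fixed: "real (card ({..<n} - free q u)) \<le> 4 / (\<beta> * \<zeta>\<^sup>2)"
    if q: "\<zeta> \<le> q" "\<zeta> \<le> 1 - q" and u: "\<beta> \<le> measure_pmf.expectation (\<mu> n q) (\<lambda>y. of_bool (u y))" for q u
  proof -
    define l :: real where "l = measure_pmf.expectation (\<mu> n q) (\<lambda>y. of_bool (u y))"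
    have l: "\<beta> \<le> l" "0 < l"
      using u \<beta> by (auto simp: l_def)
    have "\<alpha> \<le> l * (1 - q) / 2"
      using l q \<zeta> \<beta> by (simp add: \<alpha>_def mult_mono)
    then have "card ({..<n} - free q u) * (l * (1 - q)\<^sup>2) \<le> 4"
      using q \<zeta> l by (intro card_biased_coordinates_le[where h = u and n = n]) (auto simp: l_def free_def)
    moreover have "\<beta> * \<zeta>\<^sup>2 \<le> l * (1 - q)\<^sup>2"
      using l q \<zeta> \<beta> by (intro mult_mono power_mono) auto
    then have "card ({..<n} - free q u) * (\<beta> * \<zeta>\<^sup>2) \<le> card ({..<n} - free q u) * (l * (1 - q)\<^sup>2)"
      by (intro mult_left_mono) auto
    ultimately show ?thesis
      using \<beta> \<zeta> by (simp add: field_simps)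
  qed
  have "real (card ({..<n} - K)) \<le> real (card ({..<n} - free p g)) + real (card ({..<n} - free r h))"
    unfolding K_def Diff_Int of_nat_add[symmetric] of_nat_le_iff by (rule card_Un_le)
  also have "\<dots> \<le> 4 / (\<beta> * \<zeta>\<^sup>2) + 4 / (\<beta> * \<zeta>\<^sup>2)"
    using \<zeta> g h by (intro add_mono card_fixed) auto
  also have "\<dots> \<le> real M"
    using \<beta> by simp
  finally have "card ({..<n} - K) \<le> M"
    by simp
  define \<kappa> where "\<kappa> = \<zeta> ^ card ({..<n} - K)"
  have \<kappa>: "\<zeta> ^ M \<le> \<kappa>"
    unfolding \<kappa>_def using \<zeta> \<open>\<zeta> \<le> 1\<close> \<open>card ({..<n} - K) \<le> M\<close> by (intro power_decreasing) auto
  have "\<alpha> * (\<zeta> ^ M * (\<theta> / 2)) \<le> \<alpha> * (\<kappa> * (\<theta> / 2))" and "(\<zeta> ^ M)\<^sup>2 * \<theta> \<le> \<kappa>\<^sup>2 * \<theta>"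
    using \<kappa> \<open>0 < \<alpha>\<close> \<theta> \<zeta> by (auto intro!: mult_left_mono mult_right_mono power_mono)
  then have \<eta>': "\<eta> \<le> \<alpha> * (\<kappa> * (\<theta> / 2))" "\<eta> \<le> \<kappa>\<^sup>2 * \<theta>"
    using \<eta> by (auto simp: \<alpha>_def)
  have error': "measure_pmf.expectation (\<mu> n r) (\<lambda>y. measure_pmf.expectation (\<mu> n p)
      (\<lambda>x. of_bool (f (cube_and x y) \<noteq> (g x \<and> h y)))) \<le> \<eta>"
    using error by (simp add: expectation_\<mu>_swap[of n p r])
  let ?f = "resample (r * p) K (\<lambda>x. of_bool (f x))"
  let ?g = "resample p K (\<lambda>x. of_bool (g x))"
  let ?h = "resample r K (\<lambda>x. of_bool (h x))"
  have "\<alpha> * measure_pmf.expectation (\<mu> n p) (\<lambda>x. (of_bool (g x) - ?g x)\<^sup>2) \<le> \<eta>"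
    by (rule stability[OF K _ error']) (auto simp: K_def free_def)
  also note \<eta>'(1)
  finally have var_g: "measure_pmf.expectation (\<mu> n p) (\<lambda>x. (of_bool (g x) - ?g x)\<^sup>2) \<le> \<kappa> * (\<theta> / 2)"
    using \<open>0 < \<alpha>\<close> by simp
  have "measure_pmf.expectation (\<mu> n p) (\<lambda>x. measure_pmf.expectation (\<mu> n r)
      (\<lambda>y. of_bool (f (cube_and y x) \<noteq> (h y \<and> g x)))) \<le> \<eta>"
    using error by (simp add: cube_and_commute conj_commute)
  then have "\<alpha> * measure_pmf.expectation (\<mu> n r) (\<lambda>x. (of_bool (h x) - ?h x)\<^sup>2) \<le> \<eta>"
    by (rule stability[OF K, rotated]) (auto simp: K_def free_def)
  also note \<eta>'(1)
  finally have var_h: "measure_pmf.expectation (\<mu> n r) (\<lambda>x. (of_bool (h x) - ?h x)\<^sup>2) \<le> \<kappa> * (\<theta> / 2)"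
    using \<open>0 < \<alpha>\<close> by simp
  define C :: "(nat \<Rightarrow> bool) set" where "C = {x. \<forall>i\<ge>n. \<not> x i}"
  define F G H where "F = (\<lambda>x. ?f x > 1 / 2)" and "G = (\<lambda>x. ?g x > 1 / 2)" and "H = (\<lambda>x. ?h x > 1 / 2)"
  have near_g: "\<bar>?g x - of_bool (G x)\<bar> \<le> \<theta>" if "x \<in> C" for x
    unfolding G_def
    by (rule resample_bool_near_0_or_1[OF K]) (use that \<zeta> \<theta> var_g in \<open>auto simp: C_def \<kappa>_def\<close>)
  have near_h: "\<bar>?h x - of_bool (H x)\<bar> \<le> \<theta>" if "x \<in> C" for x
    unfolding H_def
    by (rule resample_bool_near_0_or_1[OF K]) (use that \<zeta> \<theta> var_h in \<open>auto simp: C_def \<kappa>_def\<close>)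
  \<comment> \<open>One \<theta> comes from the localized equation, and one each from rounding the
    means of \<open>g\<close> and \<open>h\<close>.\<close>
  have near_gh: "\<bar>?f (cube_and a b) - of_bool (G a \<and> H b)\<bar> \<le> 3 * \<theta>" if "a \<in> C" "b \<in> C" for a b
  proof -
    have "\<bar>?f (cube_and a b) - ?g a * ?h b\<bar> \<le> \<theta>"
      by (rule biased_expectations_near[OF K \<zeta>])
         (use error \<eta>' that in \<open>auto simp: C_def \<kappa>_def\<close>)
    moreover have "\<bar>?g a * ?h b - of_bool (G a \<and> H b)\<bar> \<le> 2 * \<theta>"
    proof -
      have "\<bar>?g a * ?h b - of_bool (G a \<and> H b)\<bar> =
          \<bar>(?g a - of_bool (G a)) * ?h b + of_bool (G a) * (?h b - of_bool (H b))\<bar>"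
        by (simp add: algebra_simps)
      also have "\<dots> \<le> \<bar>?g a - of_bool (G a)\<bar> * \<bar>?h b\<bar> + \<bar>of_bool (G a)\<bar> * \<bar>?h b - of_bool (H b)\<bar>"
        unfolding abs_mult[symmetric] by (rule abs_triangle_ineq)
      also have "\<dots> \<le> \<theta> * 1 + 1 * \<theta>"
        using near_g[OF that(1)] near_h[OF that(2)] \<theta> fin
          resample_bool_bounds(1)[of r K h b] resample_bool_bounds(2)[of K r h b]
        by (intro add_mono mult_mono) auto
      finally show ?thesis by simp
    qed
    ultimately show ?thesis by linarith
  qed
  \<comment> \<open>The error \<open>3 * \<theta>\<close> is at most 3/8, below 1/2, so rounding is
    unambiguous.\<close>
  have poly: "F (cube_and a b) \<longleftrightarrow> G a \<and> H b" if "a \<in> C" "b \<in> C" for a b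
    using near_gh[OF that] \<theta> by (cases "G a \<and> H b") (auto simp: F_def)
  \<comment> \<open>Each \<open>x\<close> is \<open>cube_and x x\<close>, so the bound for pairs
    covers the whole cube.\<close>
  have near_f: "\<bar>?f x - of_bool (F x)\<bar> \<le> 3 * \<theta>" if "x \<in> C" for x
    using near_gh[OF that that] poly[OF that that] by (simp add: cube_and_def)
  have close_f: "is_close n (r * p) (3 * \<theta>) f F'" if "\<And>x. x \<in> C \<Longrightarrow> F x = F' x" for F'
    by (rule is_close_if_resample_near[OF K, of F]) (use near_f that in \<open>auto simp: F_def C_def\<close>)
  have close_g: "is_close n p \<theta> g G'" if "\<And>x. x \<in> C \<Longrightarrow> G x = G' x" for G'
    by (rule is_close_if_resample_near[OF K, of G]) (use near_g that in \<open>auto simp: G_def C_def\<close>)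
  have close_h: "is_close n r \<theta> h H'" if "\<And>x. x \<in> C \<Longrightarrow> H x = H' x" for H'
    by (rule is_close_if_resample_near[OF K, of H]) (use near_h that in \<open>auto simp: H_def C_def\<close>)
  consider "\<forall>x\<in>C. \<not> F x" "(\<forall>x\<in>C. \<not> G x) \<or> (\<forall>x\<in>C. \<not> H x)"
    | T where "T \<subseteq> {..<n}" "\<forall>x\<in>C. F x = AND_fun T x \<and> G x = AND_fun T x \<and> H x = AND_fun T x"
    using exact_and_polymorphism[of n F G H, folded C_def, OF poly] by blast
  then show ?thesis
  proof cases
    case 1
    then show ?thesis
      using close_f[of "\<lambda>_. False"] close_g[of "\<lambda>_. False"] close_h[of "\<lambda>_. False"] by auto
  next
    case (2 T)
    then show ?thesis
      using close_f[of "AND_fun T"] close_g[of "AND_fun T"] close_h[of "AND_fun T"] by auto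
  qed
qed

lemma is_close_mono: "is_close n q \<epsilon> F G \<Longrightarrow> \<epsilon> \<le> \<epsilon>' \<Longrightarrow> is_close n q \<epsilon>' F G"
  by (simp add: is_close_def)

theorem theorem2p10:
  fixes \<zeta> \<epsilon> :: real
  assumes "\<zeta> > 0" and "\<epsilon> > 0"
  shows "\<exists>\<eta>>0. \<forall>(n::nat) (p::real) (\<rho>::real) (f :: (nat \<Rightarrow> bool) \<Rightarrow> bool)
            (g :: (nat \<Rightarrow> bool) \<Rightarrow> bool) (h :: (nat \<Rightarrow> bool) \<Rightarrow> bool).
          p \<in> {\<zeta>..1 - \<zeta>} \<longrightarrow> \<rho> \<in> {\<zeta>..1 - \<zeta>} \<longrightarrow>
          measure_pmf.prob (pair_pmf (\<mu> n p) (\<mu> n \<rho>))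
            {(x, y). f (cube_and x y) = (g x \<and> h y)} \<ge> 1 - \<eta> \<longrightarrow>
          (is_close n (\<rho> * p) \<epsilon> f (\<lambda>_. False) \<and>
             (is_close n p \<epsilon> g (\<lambda>_. False) \<or> is_close n \<rho> \<epsilon> h (\<lambda>_. False))) \<or>
          (\<exists>T\<subseteq>{..<n}. is_close n (\<rho> * p) \<epsilon> f (AND_fun T) \<and>
             is_close n p \<epsilon> g (AND_fun T) \<and> is_close n \<rho> \<epsilon> h (AND_fun T))"
proof -
  \<comment> \<open>A factor of mean below \<beta> is close to 0, and then \<open>f\<close> has mean
    at most \<open>\<eta> + \<beta>\<close>, which is at most \<epsilon>.\<close>
  define \<beta> where "\<beta> = \<epsilon> / 2"
  define \<theta> where "\<theta> = min \<epsilon> 1 / 8"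
  define M where "M = nat \<lceil>8 / (\<beta> * \<zeta>\<^sup>2)\<rceil>"
  \<comment> \<open>The three bounds serve the case of a small factor, the variance bounds from
    stability, and the localization of the equation. \<open>M\<close> does not depend on
    \<open>n\<close>, so neither does \<eta>.\<close>
  define \<eta> where "\<eta> = min (\<epsilon> / 2) (min (\<beta> * \<zeta> / 2 * (\<zeta> ^ M * (\<theta> / 2))) ((\<zeta> ^ M)\<^sup>2 * \<theta>))"
  have \<beta>: "0 < \<beta>" "8 / (\<beta> * \<zeta>\<^sup>2) \<le> real M"
    using assms by (auto simp: \<beta>_def M_def of_nat_ceiling)
  have \<theta>: "0 < \<theta>" "\<theta> \<le> 1 / 8" "\<theta> \<le> \<epsilon>" "3 * \<theta> \<le> \<epsilon>"
    using assms by (auto simp: \<theta>_def)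
  have "0 < \<eta>"
    using assms \<beta> \<theta> by (simp add: \<eta>_def)
  moreover have "(is_close n (\<rho> * p) \<epsilon> f (\<lambda>_. False) \<and>
        (is_close n p \<epsilon> g (\<lambda>_. False) \<or> is_close n \<rho> \<epsilon> h (\<lambda>_. False))) \<or>
      (\<exists>T\<subseteq>{..<n}. is_close n (\<rho> * p) \<epsilon> f (AND_fun T) \<and>
        is_close n p \<epsilon> g (AND_fun T) \<and> is_close n \<rho> \<epsilon> h (AND_fun T))"
    if p: "p \<in> {\<zeta>..1 - \<zeta>}" and \<rho>: "\<rho> \<in> {\<zeta>..1 - \<zeta>}"
      and prob: "measure_pmf.prob (pair_pmf (\<mu> n p) (\<mu> n \<rho>))
        {(x, y). f (cube_and x y) = (g x \<and> h y)} \<ge> 1 - \<eta>"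
    for n p \<rho> and f g h :: "(nat \<Rightarrow> bool) \<Rightarrow> bool"
  proof -
    let ?P = "measure_pmf.expectation (\<mu> n p)"
    let ?R = "measure_pmf.expectation (\<mu> n \<rho>)"
    have range: "0 \<le> p" "p \<le> 1" "0 \<le> \<rho>" "\<rho> \<le> 1"
      using p \<rho> assms by auto
    have "measure_pmf.prob (pair_pmf (\<mu> n p) (\<mu> n \<rho>)) {(x, y). f (cube_and x y) = (g x \<and> h y)} =
        ?P (\<lambda>x. ?R (\<lambda>y. of_bool (f (cube_and x y) = (g x \<and> h y))))"
      by (simp add: case_prod_unfold prob_Collect_eq_expectation expectation_pair_pmf_finite finite_set_\<mu>)
    also have "\<dots> = ?P (\<lambda>x. ?R (\<lambda>y. 1 - of_bool (f (cube_and x y) \<noteq> (g x \<and> h y))))"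
      by (intro Bochner_Integration.integral_cong refl) auto
    finally have error: "?P (\<lambda>x. ?R (\<lambda>y. of_bool (f (cube_and x y) \<noteq> (g x \<and> h y)))) \<le> \<eta>"
      using prob by simp
    show ?thesis
    proof (cases "\<beta> \<le> ?P (\<lambda>x. of_bool (g x)) \<and> \<beta> \<le> ?R (\<lambda>y. of_bool (h y))")
      case True
      have "is_close n (\<rho> * p) (3 * \<theta>) f (\<lambda>_. False) \<and>
            (is_close n p \<theta> g (\<lambda>_. False) \<or> is_close n \<rho> \<theta> h (\<lambda>_. False)) \<or>
          (\<exists>T\<subseteq>{..<n}. is_close n (\<rho> * p) (3 * \<theta>) f (AND_fun T) \<and>
            is_close n p \<theta> g (AND_fun T) \<and> is_close n \<rho> \<theta> h (AND_fun T))"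
        by (rule polymorphism_of_large_factors[OF _ _ _ _ _ \<theta>(1,2) \<beta> _ _ error])
           (use True assms p \<rho> in \<open>auto simp: \<eta>_def\<close>)
      then show ?thesis
        using is_close_mono[OF _ \<theta>(3)] is_close_mono[OF _ \<theta>(4)] by meson
    next
      case False
      \<comment> \<open>If \<open>f\<close> is true at the AND, then the equation fails or both
        factors are true. Below, \<open>u\<close> is taken to be whichever factor has small
        mean.\<close>
      have le: "measure_pmf.expectation (\<mu> n (\<rho> * p)) (\<lambda>x. of_bool (f x)) \<le>
          \<eta> + ?P (\<lambda>x. ?R (\<lambda>y. of_bool (u x y)))"
        if "\<And>x y. g x \<and> h y \<Longrightarrow> u x y" for u :: "(nat \<Rightarrow> bool) \<Rightarrow> (nat \<Rightarrow> bool) \<Rightarrow> bool"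
      proof -
        have "measure_pmf.expectation (\<mu> n (\<rho> * p)) (\<lambda>x. of_bool (f x)) =
            ?P (\<lambda>x. ?R (\<lambda>y. of_bool (f (cube_and x y)) :: real))"
          by (rule expectation_\<mu>_cube_and[symmetric]) (use range in auto)
        also have "\<dots> \<le> ?P (\<lambda>x. ?R (\<lambda>y. of_bool (f (cube_and x y) \<noteq> (g x \<and> h y)) + of_bool (u x y)))"
          using that by (intro integral_mono) auto
        also have "\<dots> \<le> \<eta> + ?P (\<lambda>x. ?R (\<lambda>y. of_bool (u x y)))"
          using error by simp
        finally show ?thesis .
      qed
      have "measure_pmf.expectation (\<mu> n (\<rho> * p)) (\<lambda>x. of_bool (f x)) \<le> \<epsilon>"
        using False le[of "\<lambda>x y. g x"] le[of "\<lambda>x y. h y"] by (auto simp: \<beta>_def \<eta>_def)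
      moreover have "?P (\<lambda>x. of_bool (g x)) \<le> \<epsilon> \<or> ?R (\<lambda>y. of_bool (h y)) \<le> \<epsilon>"
        using False assms by (auto simp: \<beta>_def)
      ultimately show ?thesis
        by (simp add: is_close_def prob_Collect_eq_expectation)
    qed
  qed
  ultimately show ?thesis
    by blast
qed

end
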